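(* Let $X$ be a set, let $M \ge 1$ be a real number and let $\mathcal{S}$ be a matrix-like semigroup of functions from $X \times X$ to $[0, M]$. Then there exists a function $d : X \to [\frac{1}{M}, M]$ such that $$ f(x, y) \le \frac{d(x)}{d(y)} $$ for all $f \in \mathcal{S}$ and all $x, y \in X$.
   Context: A set $\mathcal{S}$ of nonnegative real-valued functions on $X \times X$, closed under a given associative operation $*$, is called a matrix-like semigroup if $(f*g)(x,z) \ge f(x,y)\, g(y,z)$ for all $f, g \in \mathcal{S}$ and all $x, y, z \in X$. *)

theory Defs
  imports Complex_Main "HOL-Library.FuncSet"
begin

text \<open>A function on \<open>X \<times> X\<close> is an element of \<open>X \<times> X \<rightarrow>\<^sub>E B\<close>, so that it is determined by its
  values on \<open>X \<times> X\<close>; \<open>X\<close> may be empty. The operation \<open>mult\<close> is an arbitrary binary operation,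
  relevant only on \<open>S\<close>; it is not assumed to be given by any pointwise formula.\<close>

definition matrix_like_semigroup ::
  "'a set \<Rightarrow> ('a \<times> 'a \<Rightarrow> real) set \<Rightarrow>
    (('a \<times> 'a \<Rightarrow> real) \<Rightarrow> ('a \<times> 'a \<Rightarrow> real) \<Rightarrow> ('a \<times> 'a \<Rightarrow> real)) \<Rightarrow> bool"
  where
  "matrix_like_semigroup X S mult \<longleftrightarrow>
     S \<subseteq> (X \<times> X \<rightarrow>\<^sub>E {0..}) \<and>
     (\<forall>f\<in>S. \<forall>g\<in>S. mult f g \<in> S) \<and>
     (\<forall>f\<in>S. \<forall>g\<in>S. \<forall>h\<in>S. mult (mult f g) h = mult f (mult g h)) \<and>
     (\<forall>f\<in>S. \<forall>g\<in>S. \<forall>x\<in>X. \<forall>y\<in>X. \<forall>z\<in>X. mult f g (x, z) \<ge> f (x, y) * g (y, z))"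

end

theory Submission imports Defs begin

text \<open>Take \<open>d x\<close> to be the supremum of \<open>1\<close> and all values \<open>g (x, z)\<close> with \<open>g \<in> S\<close> and \<open>z \<in> X\<close>.
  Multiplying any of the numbers whose supremum is \<open>d y\<close> by \<open>f (x, y)\<close> gives \<open>f (x, y)\<close> itself
  or at most \<open>mult f g (x, z)\<close>, hence at most \<open>d x\<close>.\<close>

theorem theorem2p5:
  fixes X :: "'a set" and M :: real
    and S :: "('a \<times> 'a \<Rightarrow> real) set"
    and mult :: "('a \<times> 'a \<Rightarrow> real) \<Rightarrow> ('a \<times> 'a \<Rightarrow> real) \<Rightarrow> ('a \<times> 'a \<Rightarrow> real)"
  assumes "M \<ge> 1"
    and "matrix_like_semigroup X S mult"
    and "S \<subseteq> (X \<times> X \<rightarrow>\<^sub>E {0..M})"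
  shows "\<exists>d \<in> X \<rightarrow> {1 / M..M}. \<forall>f\<in>S. \<forall>x\<in>X. \<forall>y\<in>X. f (x, y) \<le> d x / d y"
proof -
  have range: "0 \<le> f (x, y) \<and> f (x, y) \<le> M" if "f \<in> S" "x \<in> X" "y \<in> X" for f x y
  proof -
    have "f \<in> X \<times> X \<rightarrow>\<^sub>E {0..M}" using assms(3) that(1) by blast
    then have "f (x, y) \<in> {0..M}" using that by (auto dest: PiE_mem)
    then show ?thesis by simp
  qed
  have closed: "mult f g \<in> S" if "f \<in> S" "g \<in> S" for f g
    using assms(2) that unfolding matrix_like_semigroup_def by blast
  have super: "f (x, y) * g (y, z) \<le> mult f g (x, z)"
    if "f \<in> S" "g \<in> S" "x \<in> X" "y \<in> X" "z \<in> X" for f g x y z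
    using assms(2) that unfolding matrix_like_semigroup_def by blast
  \<comment> \<open>The element \<open>1\<close> keeps \<open>D x\<close> nonempty even when
    \<open>S\<close> is empty and forces \<open>d x \<ge> 1\<close>, so that dividing by
    \<open>d y\<close> is harmless. As \<open>M \<ge> 1\<close>, it respects the upper bound
    \<open>M\<close>.\<close>
  define D where "D x = insert 1 {g (x, z) | g z. g \<in> S \<and> z \<in> X}" for x
  define d where "d x = Sup (D x)" for x
  have D_le: "t \<le> M" if "x \<in> X" "t \<in> D x" for x t
    using that range assms(1) by (auto simp: D_def)
  have le_d: "t \<le> d x" if "x \<in> X" "t \<in> D x" for x t
    unfolding d_def using that D_le by (intro cSup_upper bdd_aboveI[of _ M]) auto
  have d_ge: "1 \<le> d x" if "x \<in> X" for x
    using le_d[OF that] by (simp add: D_def)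
  have d_le: "d x \<le> c" if "\<And>t. t \<in> D x \<Longrightarrow> t \<le> c" for x c
    unfolding d_def using that by (intro cSup_least) (auto simp: D_def)
  have "f (x, y) \<le> d x / d y" if f: "f \<in> S" and x: "x \<in> X" and y: "y \<in> X" for f x y
  proof (cases "f (x, y) = 0")
    case True
    then show ?thesis using d_ge[OF x] d_ge[OF y] by simp
  next
    case False
    then have pos: "0 < f (x, y)" using range[OF f x y] by simp
    \<comment> \<open>With \<open>d y\<close> isolated, the claim says that the right-hand side is
      an upper bound of \<open>D y\<close>, which can be checked one element at a time. This
      division is why the value \<open>0\<close> is treated separately.\<close>
    have "d y \<le> d x / f (x, y)"
    proof (rule d_le)
      fix t assume "t \<in> D y"
      then consider "t = 1" | g z where "g \<in> S" "z \<in> X" "t = g (y, z)"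
        by (auto simp: D_def)
      then have "f (x, y) * t \<le> d x"
      proof cases
        case 1
        then show ?thesis using le_d[OF x] f y by (auto simp: D_def)
      next
        case 2
        then have "f (x, y) * t \<le> mult f g (x, z)" using super f x y by simp
        \<comment> \<open>By closure \<open>mult f g\<close> is itself a member of \<open>S\<close>,
          so its value at \<open>(x, z)\<close> belongs to \<open>D x\<close>.\<close>
        also have "\<dots> \<le> d x" using closed[OF f 2(1)] 2(2) by (intro le_d[OF x]) (auto simp: D_def)
        finally show ?thesis .
      qed
      then show "t \<le> d x / f (x, y)" using pos by (simp add: field_simps)
    qed
    then show ?thesis using pos d_ge[OF y] by (simp add: field_simps)
  qed
  moreover have "d \<in> X \<rightarrow> {1 / M..M}"
  proof
    fix x assume x: "x \<in> X"
    \<comment> \<open>The values of \<open>d\<close> lie even in \<open>{1..M}\<close>; the upper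
      bound is \<open>d_le\<close> with \<open>c = M\<close>.\<close>
    have "1 / M \<le> 1" using assms(1) by simp
    then show "d x \<in> {1 / M..M}" using d_ge[OF x] d_le D_le[OF x] by fastforce
  qed
  ultimately show ?thesis by blast
qed

end
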